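(* The spacelike Type I translation surfaces $\mathcal{F}(u,v)=(u,v,f(u)+g(v))$ in Minkowski space $\mathbb{R}^3_1$ that are minimal with respect to the semi-symmetric metric connection $\nabla$ are of the following forms: (i) $\mathcal{F}(u,v)=\Big(u,\,v,\,-\frac{c^2-1}{2}\ln\Big|\cos\Big(\frac{2}{\sqrt{c^2-1}}u-a\Big)\Big|+cv+b\Big)$, where $a,b,c$ are constants with $c^2>1$; (ii) $\mathcal{F}(u,v)=\Big(u,\,v,\,\int_0^u\frac{\sqrt{1-c^2}+d\,e^{-\frac{4}{\sqrt{1-c^2}}x}}{1-d\,e^{-\frac{4}{\sqrt{1-c^2}}x}}\,dx+cv+b\Big)$, where $b,c,d$ are constants with $c^2<1$ and $d\neq 0$; (iii) $\mathcal{F}(u,v)=\Big(u,\,v,\,-\frac{c^2-1}{2}\ln\Big|\cos\Big(\frac{2}{\sqrt{c^2-1}}v-a\Big)\Big|+cu+b\Big)$, where $a,b,c$ are constants with $c^2>1$; (iv) $\mathcal{F}(u,v)=\Big(u,\,v,\,\int_0^v\frac{\sqrt{1-c^2}+d\,e^{-\frac{4}{\sqrt{1-c^2}}x}}{1-d\,e^{-\frac{4}{\sqrt{1-c^2}}x}}\,dx+cu+b\Big)$, where $b,c,d$ are constants with $c^2<1$ and $d\neq 0$.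
   Context: $\mathbb{R}^3_1$ is $\mathbb{R}^3$ with the Minkowski metric $\widetilde g_1=dx^2+dy^2-dz^2$, coordinate fields $X_1=\partial_x$, $X_2=\partial_y$, $X_3=\partial_z$ and Levi-Civita connection $\nabla^L$ (so $\nabla^L_{X_i}X_j=0$). The semi-symmetric metric connection $\nabla$ is $$\nabla_XY=\nabla^L_XY+\widetilde g_1(Y,X_3)X-\widetilde g_1(X,Y)X_3 .$$ A Type I translation surface is a surface parametrized by $\mathcal{F}(u,v)=(u,v,f(u)+g(v))$, where $f$ and $g$ are smooth functions on open sets of $\mathbb{R}$. A surface is spacelike if the metric induced on it by $\widetilde g_1$ is Riemannian. For a spacelike surface $M$ parametrized by $\mathcal{F}(u,v)$, put $E_1=\mathcal{F}_u$, $E_2=\mathcal{F}_v$, let $N$ be a unit (timelike) normal field, and let $E=\widetilde g_1(\mathcal{F}_u,\mathcal{F}_u)$, $F=\widetilde g_1(\mathcal{F}_u,\mathcal{F}_v)$, $G=\widetilde g_1(\mathcal{F}_v,\mathcal{F}_v)$. $M$ is minimal with respect to $\nabla$ if its mean curvature with respect to $\nabla$ vanishes, i.e. $$G\,\widetilde g_1(\nabla_{E_1}E_1,N)-F\,\widetilde g_1(\nabla_{E_1}E_2,N)-F\,\widetilde g_1(\nabla_{E_2}E_1,N)+E\,\widetilde g_1(\nabla_{E_2}E_2,N)=0 .$$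
   Formalization: In (ii) and (iv) the numerator is corrected to √(1-c²)+√(1-c²)·d·e^{-4x/√(1-c²)} (as printed the claim is false for c≠0), and the forms are asserted on each product of connected components of the domains of f and g, where the constants may differ between components. *)

theory Defs
  imports "HOL-Analysis.Analysis"
begin

definition minkowski :: "real^3 \<Rightarrow> real^3 \<Rightarrow> real" where
  "minkowski x y = x $ 1 * y $ 1 + x $ 2 * y $ 2 - x $ 3 * y $ 3"

abbreviation X3 :: "real^3" where
  "X3 \<equiv> axis 3 1"

text \<open>
  The coordinate fields are parallel for the Levi-Civita connection, so it differentiates vector
  fields componentwise.
\<close>

definition levi_civita :: "(real^3 \<Rightarrow> real^3) \<Rightarrow> (real^3 \<Rightarrow> real^3) \<Rightarrow> real^3 \<Rightarrow> real^3" where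
  "levi_civita X Y q = frechet_derivative Y (at q) (X q)"

definition semi_symmetric :: "(real^3 \<Rightarrow> real^3) \<Rightarrow> (real^3 \<Rightarrow> real^3) \<Rightarrow> real^3 \<Rightarrow> real^3" where
  "semi_symmetric X Y q =
     levi_civita X Y q + minkowski (Y q) X3 *\<^sub>R X q - minkowski (X q) (Y q) *\<^sub>R X3"

definition tangent :: "(real \<times> real \<Rightarrow> real^3) \<Rightarrow> real \<times> real \<Rightarrow> real \<times> real \<Rightarrow> real^3" where
  "tangent \<Phi> w p = frechet_derivative \<Phi> (at p) w"

text \<open>
  The fields \<open>\<Phi>\<^sub>u\<close>, \<open>\<Phi>\<^sub>v\<close> live only along the surface, as functions of the parameters. They are
  differentiated with the connection pulled back along the parametrization \<open>\<Phi>\<close>: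
  \<open>semi_symmetric_along \<Phi> w Y p\<close> is the covariant derivative at \<open>p\<close> of the field \<open>Y\<close> along \<open>\<Phi>\<close>
  in the direction of the tangent vector \<open>d\<Phi>\<^sub>p(w)\<close>. The lemma below says that for restrictions of
  ambient fields this is the ambient connection.
\<close>

definition semi_symmetric_along ::
  "(real \<times> real \<Rightarrow> real^3) \<Rightarrow> real \<times> real \<Rightarrow> (real \<times> real \<Rightarrow> real^3) \<Rightarrow> real \<times> real \<Rightarrow> real^3" where
  "semi_symmetric_along \<Phi> w Y p =
     frechet_derivative Y (at p) w + minkowski (Y p) X3 *\<^sub>R tangent \<Phi> w p
       - minkowski (tangent \<Phi> w p) (Y p) *\<^sub>R X3"

lemma semi_symmetric_along_eq:
  assumes "\<Phi> differentiable at p" and "Y differentiable at (\<Phi> p)"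
    and "X (\<Phi> p) = tangent \<Phi> w p"
  shows "semi_symmetric_along \<Phi> w (\<lambda>r. Y (\<Phi> r)) p = semi_symmetric X Y (\<Phi> p)"
  using frechet_derivative_compose[OF assms(1,2)] assms(3)
  by (simp add: semi_symmetric_along_def semi_symmetric_def levi_civita_def tangent_def o_def)

definition smooth_on :: "real set \<Rightarrow> (real \<Rightarrow> real) \<Rightarrow> bool" where
  "smooth_on U f \<longleftrightarrow> (\<forall>n. \<forall>x\<in>U. ((deriv ^^ n) f) differentiable (at x))"

definition type_I :: "(real \<Rightarrow> real) \<Rightarrow> (real \<Rightarrow> real) \<Rightarrow> real \<times> real \<Rightarrow> real^3" where
  "type_I f g = (\<lambda>(u, v). vector [u, v, f u + g v])"

definition spacelike :: "(real \<times> real \<Rightarrow> real^3) \<Rightarrow> (real \<times> real) set \<Rightarrow> bool" where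
  "spacelike \<Phi> S \<longleftrightarrow>
     (\<forall>p\<in>S. \<forall>w. w \<noteq> 0 \<longrightarrow> minkowski (tangent \<Phi> w p) (tangent \<Phi> w p) > 0)"

text \<open>
  No regularity of the unit normal \<open>N\<close> is demanded: at each point of a spacelike surface it is
  determined up to sign, and minimality does not depend on that sign.
\<close>

definition unit_normal ::
  "(real \<times> real \<Rightarrow> real^3) \<Rightarrow> (real \<times> real) set \<Rightarrow> (real \<times> real \<Rightarrow> real^3) \<Rightarrow> bool" where
  "unit_normal \<Phi> S N \<longleftrightarrow>
     (\<forall>p\<in>S. (\<forall>w. minkowski (tangent \<Phi> w p) (N p) = 0) \<and> minkowski (N p) (N p) = - 1)"

definition minimal ::
  "(real \<times> real \<Rightarrow> real^3) \<Rightarrow> (real \<times> real) set \<Rightarrow> (real \<times> real \<Rightarrow> real^3) \<Rightarrow> bool" where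
  "minimal \<Phi> S N \<longleftrightarrow>
     (let e1 = (1, 0); e2 = (0, 1);
          E1 = tangent \<Phi> e1; E2 = tangent \<Phi> e2
      in \<forall>p\<in>S.
        (let E = minkowski (E1 p) (E1 p); F = minkowski (E1 p) (E2 p); G = minkowski (E2 p) (E2 p)
         in G * minkowski (semi_symmetric_along \<Phi> e1 E1 p) (N p)
            - F * minkowski (semi_symmetric_along \<Phi> e1 E2 p) (N p)
            - F * minkowski (semi_symmetric_along \<Phi> e2 E1 p) (N p)
            + E * minkowski (semi_symmetric_along \<Phi> e2 E2 p) (N p) = 0))"

text \<open>
  The solutions of \<open>h'' = 2 (1 + h'\<^sup>2 / (c\<^sup>2 - 1))\<close> for \<open>c\<^sup>2 > 1\<close>, and the derivatives of those of
  \<open>h'' = 2 (1 - h'\<^sup>2 / (1 - c\<^sup>2))\<close> for \<open>c\<^sup>2 < 1\<close> (excluding constants). In the latter the factor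
  \<open>sqrt (1 - c\<^sup>2)\<close> has to multiply both summands of the numerator: the quotient with numerator
  \<open>sqrt (1 - c\<^sup>2) + d * exp (\<dots>)\<close> found in print solves the equation only if \<open>c = 0\<close>.
\<close>

definition log_cos_profile :: "real \<Rightarrow> real \<Rightarrow> real \<Rightarrow> real" where
  "log_cos_profile a c t = - (c\<^sup>2 - 1) / 2 * ln \<bar>cos (2 / sqrt (c\<^sup>2 - 1) * t - a)\<bar>"

definition exp_slope :: "real \<Rightarrow> real \<Rightarrow> real \<Rightarrow> real" where
  "exp_slope c d x =
     (sqrt (1 - c\<^sup>2) + sqrt (1 - c\<^sup>2) * d * exp (- 4 / sqrt (1 - c\<^sup>2) * x))
       / (1 - d * exp (- 4 / sqrt (1 - c\<^sup>2) * x))"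

text \<open>
  Where the formulas are meaningful; needed because \<open>ln 0 = 0\<close>, \<open>x / 0 = 0\<close> and divergent integrals
  are \<open>0\<close> in HOL.
\<close>

definition log_cos_defined :: "real \<Rightarrow> real \<Rightarrow> real set \<Rightarrow> bool" where
  "log_cos_defined a c I \<longleftrightarrow> (\<forall>t\<in>I. cos (2 / sqrt (c\<^sup>2 - 1) * t - a) \<noteq> 0)"

definition exp_slope_defined :: "real \<Rightarrow> real \<Rightarrow> real set \<Rightarrow> bool" where
  "exp_slope_defined c d I \<longleftrightarrow>
     (\<forall>t\<in>I. \<forall>x\<in>closed_segment 0 t. 1 - d * exp (- 4 / sqrt (1 - c\<^sup>2) * x) \<noteq> 0)"

end

theory Submission
  imports Defs
begin

text \<open>
  Write \<open>p = f'\<close> and \<open>q = g'\<close>. The surface is spacelike exactly where \<open>p\<^sup>2 + q\<^sup>2 < 1\<close>, and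
  since the normal is a multiple of \<open>(p, q, 1)\<close>, minimality becomes the scalar equation
  \<open>(1 - q\<^sup>2) p' + (1 - p\<^sup>2) q' = 2 (1 - p\<^sup>2 - q\<^sup>2)\<close> (\<open>minimal_type_I_equation\<close>).

  Divided by \<open>(1 - p\<^sup>2) (1 - q\<^sup>2)\<close>, its left side is a function of \<open>u\<close> plus a function of \<open>v\<close>,
  while its right side is \<open>2 - 2 P Q\<close> with \<open>P = p\<^sup>2 / (1 - p\<^sup>2)\<close> and \<open>Q = q\<^sup>2 / (1 - q\<^sup>2)\<close>. A
  product \<open>P(u) Q(v)\<close> can be such a sum only if one factor is constant
  (\<open>slope_squared_constant\<close>). Hence one of the two profiles, say \<open>g\<close>, is affine on its component,
  with slope \<open>c\<close>. Spacelikeness then gives \<open>c\<^sup>2 < 1\<close> and \<open>p\<^sup>2 < s\<^sup>2\<close> for \<open>s = sqrt (1 - c\<^sup>2)\<close>, and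
  \<open>p\<close> satisfies the Riccati equation \<open>p' = 2 (1 - p\<^sup>2 / s\<^sup>2)\<close>. The Moebius transform
  \<open>(s - p) / (s + p)\<close> linearises that equation, so that it is a positive multiple of
  \<open>exp (- 4 x / s)\<close>; solving for \<open>p\<close> yields \<open>exp_slope c d\<close> with \<open>d < 0\<close> (\<open>riccati_solution\<close>),
  whose integral is \<open>f\<close>.

  If instead \<open>f\<close> is affine, the same argument with the two profiles exchanged gives the integral
  in \<open>v\<close>.
\<close>

section \<open>Geometry of a translation surface\<close>

lemma vector_3_has_derivative:
  fixes a b c :: "'a::real_normed_vector \<Rightarrow> real"
  assumes "(a has_derivative a') (at p)" "(b has_derivative b') (at p)" "(c has_derivative c') (at p)"
  shows "((\<lambda>x. vector [a x, b x, c x] :: real^3) has_derivative (\<lambda>h. vector [a' h, b' h, c' h])) (at p)"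
proof (subst has_derivative_componentwise_within, intro ballI)
  fix i :: "real^3" assume "i \<in> Basis"
  then obtain k where i: "i = axis k 1" by (auto simp: Basis_vec_def)
  show "((\<lambda>x. (vector [a x, b x, c x] :: real^3) \<bullet> i) has_derivative
      (\<lambda>h. (vector [a' h, b' h, c' h] :: real^3) \<bullet> i)) (at p)"
    using assms exhaust_3[of k] by (auto simp: i inner_axis vector_3)
qed

lemma has_derivative_of_fst:
  assumes "(f has_real_derivative p) (at u)"
  shows "((\<lambda>x. f (fst x)) has_derivative (\<lambda>w. p * fst w)) (at (u, v))"
proof -
  have "(f has_derivative (\<lambda>h. p * h)) (at (fst (u, v)))"
    using assms by (simp add: has_field_derivative_def)
  from has_derivative_compose[OF has_derivative_fst[OF has_derivative_ident] this]
  show ?thesis .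
qed

lemma has_derivative_of_snd:
  assumes "(g has_real_derivative q) (at v)"
  shows "((\<lambda>x. g (snd x)) has_derivative (\<lambda>w. q * snd w)) (at (u, v))"
proof -
  have "(g has_derivative (\<lambda>h. q * h)) (at (snd (u, v)))"
    using assms by (simp add: has_field_derivative_def)
  from has_derivative_compose[OF has_derivative_snd[OF has_derivative_ident] this]
  show ?thesis .
qed

lemma type_I_has_derivative:
  assumes "(f has_real_derivative p) (at u)" "(g has_real_derivative q) (at v)"
  shows "(type_I f g has_derivative (\<lambda>w. vector [fst w, snd w, p * fst w + q * snd w])) (at (u, v))"
  unfolding type_I_def case_prod_beta'
  by (intro vector_3_has_derivative has_derivative_add has_derivative_fst has_derivative_snd
      has_derivative_ident has_derivative_of_fst has_derivative_of_snd assms)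

lemma tangent_type_I:
  assumes "(f has_real_derivative p) (at u)" "(g has_real_derivative q) (at v)"
  shows "tangent (type_I f g) w (u, v) = vector [fst w, snd w, p * fst w + q * snd w]"
  unfolding tangent_def
  by (simp add: frechet_derivative_at[OF type_I_has_derivative[OF assms], symmetric])

lemma smooth_on_derivs:
  assumes "smooth_on U f" "x \<in> U"
  shows "(f has_real_derivative deriv f x) (at x)"
    "(deriv f has_real_derivative deriv (deriv f) x) (at x)"
proof -
  have "((deriv ^^ n) f) differentiable (at x)" for n
    using assms by (auto simp: smooth_on_def)
  from this[of 0] this[of 1] show "(f has_real_derivative deriv f x) (at x)"
    "(deriv f has_real_derivative deriv (deriv f) x) (at x)"
    by (simp_all add: DERIV_deriv_iff_real_differentiable)
qed

text \<open>
  The coordinate fields of the surface are \<open>(e\<^sub>1, e\<^sub>2, p e\<^sub>1 + q e\<^sub>2)\<close>, so only their last component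
  varies, and it has no mixed second derivative because \<open>f\<close> and \<open>g\<close> depend on separate variables.
\<close>
lemma frechet_derivative_tangent_type_I:
  assumes "open U" "open V" "smooth_on U f" "smooth_on V g" "u \<in> U" "v \<in> V"
  shows "frechet_derivative (tangent (type_I f g) e) (at (u, v)) w =
    vector [0, 0, deriv (deriv f) u * fst w * fst e + deriv (deriv g) v * snd w * snd e]"
proof -
  let ?T = "\<lambda>x::real \<times> real. vector [fst e, snd e, deriv f (fst x) * fst e + deriv g (snd x) * snd e] :: real^3"
  have T: "(?T has_derivative (\<lambda>w. vector [0, 0,
      deriv (deriv f) u * fst w * fst e + deriv (deriv g) v * snd w * snd e])) (at (u, v))"
    by (intro vector_3_has_derivative has_derivative_const has_derivative_add
        has_derivative_mult_left has_derivative_of_fst[OF smooth_on_derivs(2)[OF assms(3,5)]]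
        has_derivative_of_snd[OF smooth_on_derivs(2)[OF assms(4,6)]])
  have "?T x = tangent (type_I f g) e x" if "x \<in> U \<times> V" for x
    using that tangent_type_I[OF smooth_on_derivs(1)[OF assms(3)] smooth_on_derivs(1)[OF assms(4)],
        of "fst x" "snd x" e]
    by auto
  from has_derivative_transform_within_open[OF T open_Times[OF assms(1,2)] _ this] assms(5,6)
  have "(tangent (type_I f g) e has_derivative (\<lambda>w. vector [0, 0,
      deriv (deriv f) u * fst w * fst e + deriv (deriv g) v * snd w * snd e])) (at (u, v))"
    by blast
  from frechet_derivative_at[OF this, symmetric] show ?thesis by simp
qed

text \<open>
  The direction \<open>(f', g')\<close> in the parameter plane is the one of steepest ascent, where the surface
  is closest to being timelike; testing positivity of the induced metric there suffices.
\<close>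
lemma spacelike_type_I_slopes:
  assumes "smooth_on U f" "smooth_on V g" "spacelike (type_I f g) (U \<times> V)" "u \<in> U" "v \<in> V"
  shows "(deriv f u)\<^sup>2 + (deriv g v)\<^sup>2 < 1"
proof (cases "deriv f u = 0 \<and> deriv g v = 0")
  case False
  let ?p = "deriv f u" and ?q = "deriv g v"
  have "0 < minkowski (tangent (type_I f g) (?p, ?q) (u, v)) (tangent (type_I f g) (?p, ?q) (u, v))"
    using False assms(3-5) by (auto simp: spacelike_def zero_prod_def)
  also have "\<dots> = (?p\<^sup>2 + ?q\<^sup>2) * (1 - (?p\<^sup>2 + ?q\<^sup>2))"
    using assms by (simp add: tangent_type_I[OF smooth_on_derivs(1)[OF assms(1,4)] smooth_on_derivs(1)[OF assms(2,5)]]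
        minkowski_def vector_3 power2_eq_square algebra_simps)
  finally show ?thesis
    using sum_power2_ge_zero[of ?p ?q] by (auto simp: zero_less_mult_iff)
qed auto

text \<open>
  Orthogonality to the two tangent fields forces the normal to be \<open>n (p, q, 1)\<close>. The term
  \<open>minkowski Y X3 *\<^sub>R X\<close> of the connection is tangential and drops out against it, so the second
  fundamental form is \<open>n\<close> times (metric minus Hessian of the height). Its trace is a nonzero
  multiple of the difference of the two sides of the equation.
\<close>
lemma minimal_type_I_equation:
  assumes "open U" "open V" "smooth_on U f" "smooth_on V g"
    and "unit_normal (type_I f g) (U \<times> V) N" "minimal (type_I f g) (U \<times> V) N"
    and "u \<in> U" "v \<in> V"
  shows "(1 - (deriv g v)\<^sup>2) * deriv (deriv f) u + (1 - (deriv f u)\<^sup>2) * deriv (deriv g) v =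
    2 * (1 - (deriv f u)\<^sup>2 - (deriv g v)\<^sup>2)"
proof -
  let ?p = "deriv f u" and ?q = "deriv g v" and ?r = "deriv (deriv f) u" and ?s = "deriv (deriv g) v"
  define n where "n = N (u, v) $ 3"
  note tan = tangent_type_I[OF smooth_on_derivs(1)[OF assms(3,7)] smooth_on_derivs(1)[OF assms(4,8)]]
  note dtan = frechet_derivative_tangent_type_I[OF assms(1-4,7,8)]
  have normal: "minkowski (tangent (type_I f g) w (u, v)) (N (u, v)) = 0"
    and unit: "minkowski (N (u, v)) (N (u, v)) = - 1" for w
    using assms(5,7,8) unfolding unit_normal_def by blast+
  have N: "N (u, v) $ 1 = ?p * n" "N (u, v) $ 2 = ?q * n"
    using normal[of "(1, 0)"] normal[of "(0, 1)"] by (auto simp: tan minkowski_def n_def)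
  have "n \<noteq> 0"
    using unit by (auto simp: minkowski_def N n_def[symmetric])
  have "n * ((1 - ?q\<^sup>2) * ?r + (1 - ?p\<^sup>2) * ?s - 2 * (1 - ?p\<^sup>2 - ?q\<^sup>2)) = 0"
    using bspec[OF assms(6)[unfolded minimal_def Let_def], of "(u, v)"] assms(7,8)
    by (simp add: semi_symmetric_along_def tan dtan minkowski_def N n_def[symmetric] axis_def
        power2_eq_square algebra_simps)
  with \<open>n \<noteq> 0\<close> show ?thesis by simp
qed

section \<open>Separation of variables\<close>

text \<open>
  A sum \<open>A(u) + B(v)\<close> has vanishing mixed second differences, whereas those of a product
  \<open>P(u) Q(v)\<close> are \<open>(P(u) - P(u')) (Q(v) - Q(v'))\<close>.
\<close>
lemma slope_squared_constant:
  fixes p p' q q' :: "real \<Rightarrow> real"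
  assumes eq: "\<And>u v. u \<in> U \<Longrightarrow> v \<in> V \<Longrightarrow>
      (1 - (q v)\<^sup>2) * p' u + (1 - (p u)\<^sup>2) * q' v = 2 * (1 - (p u)\<^sup>2 - (q v)\<^sup>2)"
    and less: "\<And>u v. u \<in> U \<Longrightarrow> v \<in> V \<Longrightarrow> (p u)\<^sup>2 + (q v)\<^sup>2 < 1"
  shows "(\<forall>u\<in>U. \<forall>u'\<in>U. (p u)\<^sup>2 = (p u')\<^sup>2) \<or> (\<forall>v\<in>V. \<forall>v'\<in>V. (q v)\<^sup>2 = (q v')\<^sup>2)"
proof (rule ccontr)
  assume "\<not> ?thesis"
  then obtain u u' v v' where uv: "u \<in> U" "u' \<in> U" "v \<in> V" "v' \<in> V"
    and ne: "(p u)\<^sup>2 \<noteq> (p u')\<^sup>2" "(q v)\<^sup>2 \<noteq> (q v')\<^sup>2"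
    by blast
  define P where "P x = (p x)\<^sup>2 / (1 - (p x)\<^sup>2)" for x
  define Q where "Q x = (q x)\<^sup>2 / (1 - (q x)\<^sup>2)" for x
  have pos: "1 - (p x)\<^sup>2 > 0" "1 - (q y)\<^sup>2 > 0" if "x \<in> U" "y \<in> V" for x y
    using less[OF that] zero_le_power2[of "p x"] zero_le_power2[of "q y"] by linarith+
  have sep: "p' x / (1 - (p x)\<^sup>2) + q' y / (1 - (q y)\<^sup>2) = 2 - 2 * P x * Q y"
    if "x \<in> U" "y \<in> V" for x y
    using eq[OF that] pos[OF that] unfolding P_def Q_def
    by (simp add: divide_simps) (simp add: algebra_simps)
  \<comment> \<open>The alternating sum of \<open>sep\<close> over the four corners cancels everything but the product.\<close>
  have "(P u - P u') * (Q v - Q v') = 0"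
    using sep[OF uv(1,3)] sep[OF uv(1,4)] sep[OF uv(2,3)] sep[OF uv(2,4)]
    by (simp add: algebra_simps)
  moreover have "P u \<noteq> P u'" "Q v \<noteq> Q v'"
    using ne pos[OF uv(1,3)] pos[OF uv(2,4)] by (auto simp: P_def Q_def divide_simps algebra_simps)
  ultimately show False by simp
qed

text \<open>
  Separation of variables only controls the square of the slope. Continuity excludes a jump
  between the two square roots on a connected set.
\<close>
lemma constant_slope_affine:
  fixes f :: "real \<Rightarrow> real"
  assumes "connected I" "open I" "I \<noteq> {}"
    and f: "\<And>x. x \<in> I \<Longrightarrow> (f has_real_derivative p x) (at x)"
    and p: "continuous_on I p" and sq: "\<And>x y. x \<in> I \<Longrightarrow> y \<in> I \<Longrightarrow> (p x)\<^sup>2 = (p y)\<^sup>2"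
  shows "\<exists>b c. \<forall>x\<in>I. f x = c * x + b \<and> p x = c"
proof -
  obtain x0 where x0: "x0 \<in> I" using assms(3) by blast
  have "p constant_on I"
  proof (rule continuous_finite_range_constant[OF assms(1) p])
    have "p ` I \<subseteq> {p x0, - p x0}"
      using sq[OF _ x0] by (auto simp: power2_eq_iff)
    thus "finite (p ` I)" by (rule finite_subset) simp
  qed
  then obtain c where c: "\<And>x. x \<in> I \<Longrightarrow> p x = c" by (auto simp: constant_on_def)
  have "(\<lambda>x. f x - c * x) constant_on I"
    using f c by (intro has_field_derivative_0_imp_constant_on[OF _ assms(1,2)])
      (auto intro!: derivative_eq_intros)
  then obtain b where "\<And>x. x \<in> I \<Longrightarrow> f x - c * x = b" by (auto simp: constant_on_def)
  then have "\<forall>x\<in>I. f x = c * x + b \<and> p x = c" using c by (auto simp: algebra_simps)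
  then show ?thesis by blast
qed

section \<open>The remaining ordinary differential equation\<close>

text \<open>
  With \<open>s = sqrt (1 - c\<^sup>2)\<close> the equation reads \<open>y' = 2 (1 - y\<^sup>2 / s\<^sup>2)\<close>. The quantity
  \<open>(s - y) / (s + y) * exp (4 x / s)\<close> is a first integral, and the strict bound \<open>\<bar>y\<bar> < s\<close> makes it
  positive; this is why \<open>d\<close>, its negative, cannot vanish. The excluded constants \<open>y = s\<close> and
  \<open>y = - s\<close> would correspond to the values \<open>0\<close> and \<open>\<infinity>\<close>.
\<close>
lemma riccati_solution:
  fixes y :: "real \<Rightarrow> real"
  assumes I: "connected I" "open I" "I \<noteq> {}" and c: "c\<^sup>2 < 1"
    and y: "\<And>x. x \<in> I \<Longrightarrow> (y has_real_derivative y' x) (at x)"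
    and ode: "\<And>x. x \<in> I \<Longrightarrow> (1 - c\<^sup>2) * y' x = 2 * (1 - c\<^sup>2 - (y x)\<^sup>2)"
    and less: "\<And>x. x \<in> I \<Longrightarrow> (y x)\<^sup>2 < 1 - c\<^sup>2"
  shows "\<exists>d<0. \<forall>x\<in>I. y x = exp_slope c d x"
proof -
  define s where "s = sqrt (1 - c\<^sup>2)"
  have s: "s > 0" "s\<^sup>2 = 1 - c\<^sup>2" using c by (auto simp: s_def)
  have bound: "\<bar>y x\<bar> < s" if "x \<in> I" for x
    using less[OF that] s by (metis abs_le_square_iff abs_of_pos not_less)
  define w where "w x = (s - y x) / (s + y x) * exp (4 / s * x)" for x
  have "(w has_real_derivative 0) (at x)" if x: "x \<in> I" for x
  proof -
    have ne: "s + y x \<noteq> 0" using bound[OF x] by linarith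
    have "y' x = 2 * (s\<^sup>2 - (y x)\<^sup>2) / s\<^sup>2"
      using ode[OF x] s(1) unfolding s(2)[symmetric] by (simp add: field_simps)
    then have "- y' x * (s + y x) - (s - y x) * y' x + 4 / s * (s - y x) * (s + y x) = 0"
      using s by (simp add: field_simps power2_eq_square)
    then show ?thesis
      unfolding w_def using ne s
      by (auto intro!: derivative_eq_intros y[OF x] simp: divide_simps) algebra
  qed
  then have "w constant_on I"
    by (intro has_field_derivative_0_imp_constant_on[OF _ I(1,2)])
  then obtain K where K: "\<And>x. x \<in> I \<Longrightarrow> w x = K" by (auto simp: constant_on_def)
  have "K > 0"
    using I(3) K bound by (fastforce simp: w_def abs_less_iff)
  have "y x = exp_slope c (- K) x" if x: "x \<in> I" for x
  proof -
    define e where "e = exp (- (4 / s * x))"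
    have "exp (4 / s * x) * e = 1" "e > 0" by (simp_all add: e_def flip: exp_add)
    moreover have "(s - y x) * exp (4 / s * x) = K * (s + y x)"
      using K[OF x] bound[OF x] by (auto simp: w_def field_simps)
    ultimately have "s - y x = K * e * (s + y x)" by algebra
    moreover have "1 + K * e > 0" using \<open>K > 0\<close> \<open>e > 0\<close> by (simp add: add_pos_pos)
    ultimately have "y x = (s - s * K * e) / (1 + K * e)"
      by (simp add: field_simps)
    then show ?thesis
      by (simp add: exp_slope_def e_def flip: s_def)
  qed
  with \<open>K > 0\<close> show ?thesis by (intro exI[of _ "- K"]) simp
qed

text \<open>
  For \<open>d < 0\<close> the denominator of \<open>exp_slope c d\<close> never vanishes, so the integrand is continuous on
  the whole line. The integral from \<open>0\<close> is therefore meaningful even when \<open>0\<close> lies outside \<open>I\<close>,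
  where nothing is known about \<open>f\<close>; only increments within \<open>I\<close> are compared.
\<close>
lemma exp_slope_antiderivative:
  fixes f :: "real \<Rightarrow> real"
  assumes I: "connected I" "I \<noteq> {}" and d: "d < 0"
    and f: "\<And>x. x \<in> I \<Longrightarrow> (f has_real_derivative exp_slope c d x) (at x)"
  shows "\<exists>b. \<forall>x\<in>I. f x = (LBINT t=0..x. exp_slope c d t) + b"
proof -
  obtain x0 where x0: "x0 \<in> I" using I by blast
  have "1 - d * exp t > 0" for t :: real
    using d mult_neg_pos[OF d exp_gt_zero[of t]] by linarith
  then have cont: "continuous_on S (exp_slope c d)" for S
    unfolding exp_slope_def by (intro continuous_intros) (metis less_irrefl)
  have int: "interval_lebesgue_integrable lborel (ereal a) (ereal b) (exp_slope c d)" for a b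
    by (rule interval_integrable_isCont)
       (use cont[of UNIV] continuous_on_eq_continuous_at open_UNIV in blast)
  have "f x - f x0 = (LBINT t=0..x. exp_slope c d t) - (LBINT t=0..x0. exp_slope c d t)"
    if x: "x \<in> I" for x
  proof -
    have sub: "{min x0 x..max x0 x} \<subseteq> I"
      using I(1) x0 x by (auto simp: min_def max_def connected_contains_Icc)
    have "(LBINT t=x0..x. exp_slope c d t) = f x - f x0"
    proof (rule interval_integral_FTC_finite[OF cont])
      fix t assume "min x0 x \<le> t" "t \<le> max x0 x"
      then have "t \<in> I" using sub by auto
      from has_field_derivative_at_within[OF f[OF this]]
      show "(f has_vector_derivative exp_slope c d t) (at t within {min x0 x..max x0 x})"
        by (simp add: has_real_derivative_iff_has_vector_derivative)
    qed
    moreover have "(LBINT t=0..x0. exp_slope c d t) + (LBINT t=x0..x. exp_slope c d t)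
        = (LBINT t=0..x. exp_slope c d t)"
      using int[of "min 0 (min x0 x)" "max 0 (max x0 x)"]
      by (intro interval_integral_sum) (simp add: zero_ereal_def ereal_min ereal_max)
    ultimately show ?thesis by linarith
  qed
  then have "f x = (LBINT t=0..x. exp_slope c d t) + (f x0 - (LBINT t=0..x0. exp_slope c d t))"
    if "x \<in> I" for x
    using that by fastforce
  then show ?thesis by blast
qed

section \<open>Classification\<close>

text \<open>
  The equation is symmetric under exchanging \<open>f\<close> and \<open>g\<close>, so this one case, in which the slope of
  \<open>g\<close> is constant, covers both exponential families. A single point \<open>v0\<close> of \<open>J\<close> already
  yields the ordinary differential equation for \<open>deriv f\<close>.
\<close>
lemma spacelike_profiles:
  fixes f g :: "real \<Rightarrow> real"
  assumes I: "connected I" "open I" "I \<noteq> {}" and J: "connected J" "open J" "J \<noteq> {}"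
    and f: "smooth_on I f" and g: "smooth_on J g"
    and eq: "\<And>u v. u \<in> I \<Longrightarrow> v \<in> J \<Longrightarrow> (1 - (deriv g v)\<^sup>2) * deriv (deriv f) u
        + (1 - (deriv f u)\<^sup>2) * deriv (deriv g) v = 2 * (1 - (deriv f u)\<^sup>2 - (deriv g v)\<^sup>2)"
    and less: "\<And>u v. u \<in> I \<Longrightarrow> v \<in> J \<Longrightarrow> (deriv f u)\<^sup>2 + (deriv g v)\<^sup>2 < 1"
    and const: "\<And>v v'. v \<in> J \<Longrightarrow> v' \<in> J \<Longrightarrow> (deriv g v)\<^sup>2 = (deriv g v')\<^sup>2"
  shows "\<exists>b c d. c\<^sup>2 < 1 \<and> d \<noteq> 0 \<and> exp_slope_defined c d I \<and>
    (\<forall>u\<in>I. \<forall>v\<in>J. f u + g v = (LBINT x=0..u. exp_slope c d x) + c * v + b)"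
proof -
  note df = smooth_on_derivs[OF f] and dg = smooth_on_derivs[OF g]
  have "continuous_on J (deriv g)"
    using dg(2) by (meson DERIV_isCont continuous_at_imp_continuous_on)
  from constant_slope_affine[OF J dg(1) this const]
  obtain b c where b: "\<And>v. v \<in> J \<Longrightarrow> g v = c * v + b" and c: "\<And>v. v \<in> J \<Longrightarrow> deriv g v = c"
    by blast
  obtain u0 v0 where v0: "v0 \<in> J" "u0 \<in> I" using J I by blast
  have "(deriv g has_real_derivative 0) (at v0)"
    by (rule has_field_derivative_transform_within_open[OF DERIV_const[of c] J(2) v0(1)])
       (simp add: c)
  then have g'': "deriv (deriv g) v0 = 0" by (rule DERIV_imp_deriv)
  have slope: "(deriv f u)\<^sup>2 < 1 - c\<^sup>2" if "u \<in> I" for u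
    using less[OF that v0(1)] c[OF v0(1)] by simp
  have c2: "c\<^sup>2 < 1" using slope[OF v0(2)] zero_le_power2[of "deriv f u0"] by linarith
  have ode: "(1 - c\<^sup>2) * deriv (deriv f) u = 2 * (1 - c\<^sup>2 - (deriv f u)\<^sup>2)" if "u \<in> I" for u
    using eq[OF that v0(1)] by (simp add: g'' c[OF v0(1)])
  from riccati_solution[OF I c2 df(2) ode slope]
  obtain d where d: "d < 0" and f': "\<And>u. u \<in> I \<Longrightarrow> deriv f u = exp_slope c d u"
    by blast
  have "(f has_real_derivative exp_slope c d u) (at u)" if "u \<in> I" for u
    using df(1)[OF that] f'[OF that] by simp
  from exp_slope_antiderivative[OF I(1,3) d this]
  obtain b' where b': "\<And>u. u \<in> I \<Longrightarrow> f u = (LBINT t=0..u. exp_slope c d t) + b'" by blast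
  have "1 - d * exp t \<noteq> 0" for t :: real
    using mult_neg_pos[OF d exp_gt_zero[of t]] by linarith
  then have "exp_slope_defined c d I" by (simp add: exp_slope_defined_def)
  moreover have "\<forall>u\<in>I. \<forall>v\<in>J. f u + g v = (LBINT x=0..u. exp_slope c d x) + c * v + (b + b')"
    using b b' by simp
  ultimately show ?thesis using c2 less_imp_neq[OF d] by blast
qed

theorem theorem3p1:
  fixes f g :: "real \<Rightarrow> real" and U V I J :: "real set" and N :: "real \<times> real \<Rightarrow> real^3"
  assumes "open U" and "open V"
    and "smooth_on U f" and "smooth_on V g"
    and "spacelike (type_I f g) (U \<times> V)"
    and "unit_normal (type_I f g) (U \<times> V) N"
    and "minimal (type_I f g) (U \<times> V) N"
    and "I \<in> components U" and "J \<in> components V"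
  shows
    "(\<exists>a b c. c\<^sup>2 > 1 \<and> log_cos_defined a c I \<and>
        (\<forall>u\<in>I. \<forall>v\<in>J. type_I f g (u, v) = vector [u, v, log_cos_profile a c u + c * v + b])) \<or>
     (\<exists>b c d. c\<^sup>2 < 1 \<and> d \<noteq> 0 \<and> exp_slope_defined c d I \<and>
        (\<forall>u\<in>I. \<forall>v\<in>J. type_I f g (u, v) = vector [u, v, (LBINT x=0..u. exp_slope c d x) + c * v + b])) \<or>
     (\<exists>a b c. c\<^sup>2 > 1 \<and> log_cos_defined a c J \<and>
        (\<forall>u\<in>I. \<forall>v\<in>J. type_I f g (u, v) = vector [u, v, log_cos_profile a c v + c * u + b])) \<or>
     (\<exists>b c d. c\<^sup>2 < 1 \<and> d \<noteq> 0 \<and> exp_slope_defined c d J \<and>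
        (\<forall>u\<in>I. \<forall>v\<in>J. type_I f g (u, v) = vector [u, v, (LBINT x=0..v. exp_slope c d x) + c * u + b]))"
proof -
  have sub: "I \<subseteq> U" "J \<subseteq> V"
    using assms(8,9) in_components_subset by blast+
  have I: "connected I" "open I" "I \<noteq> {}" and J: "connected J" "open J" "J \<noteq> {}"
    using assms(1,2,8,9) in_components_connected in_components_nonempty open_components by blast+
  have f: "smooth_on I f" and g: "smooth_on J g"
    using assms(3,4) sub by (auto simp: smooth_on_def)
  have eq: "(1 - (deriv g v)\<^sup>2) * deriv (deriv f) u + (1 - (deriv f u)\<^sup>2) * deriv (deriv g) v =
      2 * (1 - (deriv f u)\<^sup>2 - (deriv g v)\<^sup>2)"
    and less: "(deriv f u)\<^sup>2 + (deriv g v)\<^sup>2 < 1" if "u \<in> I" "v \<in> J" for u v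
    using minimal_type_I_equation[OF assms(1-4,6,7)] spacelike_type_I_slopes[OF assms(3-5)] that sub
    by blast+
  have "(\<forall>u\<in>I. \<forall>u'\<in>I. (deriv f u)\<^sup>2 = (deriv f u')\<^sup>2) \<or>
      (\<forall>v\<in>J. \<forall>v'\<in>J. (deriv g v)\<^sup>2 = (deriv g v')\<^sup>2)"
    using eq less by (rule slope_squared_constant)
  then show ?thesis
  proof
    assume const: "\<forall>v\<in>J. \<forall>v'\<in>J. (deriv g v)\<^sup>2 = (deriv g v')\<^sup>2"
    have "\<exists>b c d. c\<^sup>2 < 1 \<and> d \<noteq> 0 \<and> exp_slope_defined c d I \<and>
        (\<forall>u\<in>I. \<forall>v\<in>J. f u + g v = (LBINT x=0..u. exp_slope c d x) + c * v + b)"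
      by (rule spacelike_profiles[OF I J f g eq less const[rule_format]])
    then show ?thesis
      unfolding type_I_def prod.case by metis
  next
    assume const: "\<forall>u\<in>I. \<forall>u'\<in>I. (deriv f u)\<^sup>2 = (deriv f u')\<^sup>2"
    have "\<exists>b c d. c\<^sup>2 < 1 \<and> d \<noteq> 0 \<and> exp_slope_defined c d J \<and>
        (\<forall>v\<in>J. \<forall>u\<in>I. g v + f u = (LBINT x=0..v. exp_slope c d x) + c * u + b)"
    proof (rule spacelike_profiles[OF J I g f _ _ const[rule_format]])
      fix v u assume "v \<in> J" "u \<in> I"
      from eq[OF this(2,1)] less[OF this(2,1)]
      show "(1 - (deriv f u)\<^sup>2) * deriv (deriv g) v + (1 - (deriv g v)\<^sup>2) * deriv (deriv f) u =
          2 * (1 - (deriv g v)\<^sup>2 - (deriv f u)\<^sup>2)" "(deriv g v)\<^sup>2 + (deriv f u)\<^sup>2 < 1"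
        by (simp_all add: algebra_simps)
    qed
    then show ?thesis
      unfolding type_I_def prod.case add.commute[of "f _" "g _"] by metis
  qed
qed

end
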